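(* Let $X$ be a geodesic metric space containing a bi-infinite geodesic. If $\operatorname{asdim} X = n$ with $0<n<\infty$, then there exists a subspace $Y\subseteq X$ with $\operatorname{asdim} Y < n$ which coarsely separates $X$.
   Context: Asymptotic dimension: for a metric space $X$ and an integer $n\ge 0$, $\operatorname{asdim} X\le n$ iff for every $R>0$ there is a uniformly bounded covering $\mathcal U$ of $X$ (i.e. $\sup_{U\in\mathcal U}\operatorname{diam}U<\infty$) whose $R$-multiplicity is at most $n+1$, i.e. every ball of radius $R$ in $X$ intersects at most $n+1$ elements of $\mathcal U$. Subsets carry the restricted metric. A bi-infinite geodesic is an isometric embedding $c:\mathbb R\to X$. For $A\subseteq X$, $N_R(A)$ is the set of points of $X$ at distance at most $R$ from $A$. Coarse separation: let $K\subseteq X$. A component $C$ of $X\setminus N_R(K)$ is deep if $C$ is not contained in $N_{R'}(K)$ for any $R'>0$. The set $K$ coarsely separates $X$ if there is an $R>0$ such that $X\setminus N_R(K)$ has at least two deep connected components. *)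

theory Defs
  imports "HOL-Analysis.Analysis" "HOL-Library.Extended_Nat"
begin

text \<open>
  A metric space is a subset of a type of class \<^class>\<open>metric_space\<close>, with the restricted metric.
\<close>

definition geodesic_space :: "'a::metric_space set \<Rightarrow> bool" where
  "geodesic_space X \<longleftrightarrow>
     (\<forall>x\<in>X. \<forall>y\<in>X. \<exists>g :: real \<Rightarrow> 'a.
        g ` {0..dist x y} \<subseteq> X \<and> g 0 = x \<and> g (dist x y) = y \<and>
        (\<forall>s\<in>{0..dist x y}. \<forall>t\<in>{0..dist x y}. dist (g s) (g t) = \<bar>s - t\<bar>))"

definition biinfinite_geodesic :: "'a::metric_space set \<Rightarrow> (real \<Rightarrow> 'a) \<Rightarrow> bool" where
  "biinfinite_geodesic X c \<longleftrightarrow> range c \<subseteq> X \<and> (\<forall>s t. dist (c s) (c t) = \<bar>s - t\<bar>)"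

definition covering :: "'a set \<Rightarrow> 'a set set \<Rightarrow> bool" where
  "covering X \<U> \<longleftrightarrow> \<U> \<subseteq> Pow X \<and> \<Union>\<U> = X"

text \<open>
  Boundedness has to be required separately, because the library assigns diameter \<open>0\<close> to
  unbounded sets.
\<close>

definition uniformly_bounded :: "'a::metric_space set set \<Rightarrow> bool" where
  "uniformly_bounded \<U> \<longleftrightarrow> (\<exists>D. \<forall>U\<in>\<U>. bounded U \<and> diameter U \<le> D)"

text \<open>
  Balls are closed and centred in \<open>X\<close>. The members of the covering are subsets of \<open>X\<close>, so it does
  not matter that the ball is taken in the ambient type.
\<close>

definition multiplicity_le :: "'a::metric_space set \<Rightarrow> real \<Rightarrow> 'a set set \<Rightarrow> nat \<Rightarrow> bool" where
  "multiplicity_le X R \<U> m \<longleftrightarrow>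
     (\<forall>x\<in>X. finite {U \<in> \<U>. U \<inter> cball x R \<noteq> {}} \<and> card {U \<in> \<U>. U \<inter> cball x R \<noteq> {}} \<le> m)"

definition asdim_le :: "'a::metric_space set \<Rightarrow> nat \<Rightarrow> bool" where
  "asdim_le X n \<longleftrightarrow>
     (\<forall>R>0. \<exists>\<U>. covering X \<U> \<and> uniformly_bounded \<U> \<and> multiplicity_le X R \<U> (n + 1))"

text \<open>The infimum is \<open>\<infinity>\<close> if there is no upper bound.\<close>

definition asdim :: "'a::metric_space set \<Rightarrow> enat" where
  "asdim X = Inf {enat n | n. asdim_le X n}"

text \<open>
  The condition \<open>A \<noteq> {}\<close> is needed because the library sets \<open>infdist x {} = 0\<close>; neighbourhoods of
  the empty set are empty.
\<close>

definition nbhd :: "'a::metric_space set \<Rightarrow> real \<Rightarrow> 'a set \<Rightarrow> 'a set" where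
  "nbhd X R A = {x \<in> X. A \<noteq> {} \<and> infdist x A \<le> R}"

definition deep :: "'a::metric_space set \<Rightarrow> 'a set \<Rightarrow> 'a set \<Rightarrow> bool" where
  "deep X K C \<longleftrightarrow> (\<forall>R>0. \<not> C \<subseteq> nbhd X R K)"

definition coarsely_separates :: "'a::metric_space set \<Rightarrow> 'a set \<Rightarrow> bool" where
  "coarsely_separates X K \<longleftrightarrow>
     (\<exists>R>0. \<exists>C \<in> components (X - nbhd X R K). \<exists>C' \<in> components (X - nbhd X R K).
        C \<noteq> C' \<and> deep X K C \<and> deep X K C')"

end

theory Submission
  imports Defs
begin

text \<open>
  Thicken a cone around the positive ray of the geodesic to a set \<open>Z\<close>, by adding members of covers
  of rapidly increasing scales \<open>S\<^sub>k\<close>, from coarse to fine: a member of the \<open>k\<close>-th cover is added if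
  it meets what has been added at the coarser scales and lies outside a ball of radius proportional
  to \<open>S\<^sub>k\<^sub>+\<^sub>1\<close>. The last condition keeps every point of \<open>Z\<close> within \<open>\<bar>a\<bar> / 8\<close> of some
  point \<open>a\<close> of the cone, where \<open>\<bar>a\<bar>\<close> is its distance from the center of the ball, so that \<open>Z\<close> stays far from the
  negative ray. Let \<open>Y\<close> be the set of points at distance in \<open>(0, 1]\<close> from \<open>Z\<close>; it separates the two
  rays. If \<open>y \<in> Y\<close> is far out, then the ball of radius \<open>S\<^sub>k\<close> around \<open>y\<close> meets a member of the \<open>k\<close>-th
  cover contained in \<open>Z\<close>, hence disjoint from \<open>Y\<close>. So that cover has multiplicity at most \<open>n\<close> on
  \<open>Y\<close> outside a bounded set.
\<close>

section \<open>Covers and their modification on bounded sets\<close>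

lemma uniformly_bounded_iff:
  "uniformly_bounded \<U> \<longleftrightarrow> (\<exists>D. \<forall>U\<in>\<U>. \<forall>x\<in>U. \<forall>y\<in>U. dist x y \<le> D)"
proof
  assume "uniformly_bounded \<U>"
  then show "\<exists>D. \<forall>U\<in>\<U>. \<forall>x\<in>U. \<forall>y\<in>U. dist x y \<le> D"
    unfolding uniformly_bounded_def by (meson diameter_bounded_bound order_trans)
next
  assume "\<exists>D. \<forall>U\<in>\<U>. \<forall>x\<in>U. \<forall>y\<in>U. dist x y \<le> D"
  then obtain D where D: "\<forall>U\<in>\<U>. \<forall>x\<in>U. \<forall>y\<in>U. dist x y \<le> D"
    by blast
  have "bounded U \<and> diameter U \<le> \<bar>D\<bar>" if "U \<in> \<U>" for U
  proof
    show "bounded U"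
      using D that unfolding bounded_def by blast
    have "dist x y \<le> \<bar>D\<bar>" if "x \<in> U" "y \<in> U" for x y
      using D \<open>U \<in> \<U>\<close> that by force
    then show "diameter U \<le> \<bar>D\<bar>"
      unfolding diameter_def by (auto intro!: cSUP_least)
  qed
  then show "uniformly_bounded \<U>"
    unfolding uniformly_bounded_def by blast
qed

text \<open>All members meeting the ball of radius \<open>\<rho> + R\<close> about \<open>p\<close>
  are merged into one bounded set. A ball of radius \<open>R\<close> centred within
  \<open>\<rho>\<close> of \<open>p\<close> then meets only the merged set, and elsewhere merging
  cannot raise the multiplicity.\<close>

lemma asdim_le_if_eventually:
  fixes Y :: "'a::metric_space set"
  assumes "\<And>R. R > 0 \<Longrightarrow> \<exists>\<U> \<rho>. covering Y \<U> \<and> uniformly_bounded \<U> \<and>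
      multiplicity_le {x \<in> Y. dist p x > \<rho>} R \<U> (n + 1)"
  shows "asdim_le Y n"
  unfolding asdim_le_def
proof (intro allI impI)
  fix R :: real assume "R > 0"
  then obtain \<U> \<rho> where cov: "covering Y \<U>" and bdd: "uniformly_bounded \<U>"
    and mult: "multiplicity_le {x \<in> Y. dist p x > \<rho>} R \<U> (n + 1)"
    using assms by blast
  obtain D where D: "\<And>U x y. U \<in> \<U> \<Longrightarrow> x \<in> U \<Longrightarrow> y \<in> U \<Longrightarrow> dist x y \<le> D"
    using bdd unfolding uniformly_bounded_iff by blast
  define near where "near U \<longleftrightarrow> U \<inter> cball p (\<rho> + R) \<noteq> {}" for U
  define M where "M = \<Union>{U \<in> \<U>. near U}"
  define m where "m U = (if near U then M else U)" for U
  have M_near: "dist p x \<le> \<rho> + R + D" if "x \<in> M" for x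
  proof -
    obtain U y where U: "U \<in> \<U>" "x \<in> U" "y \<in> U" "dist p y \<le> \<rho> + R"
      using \<open>x \<in> M\<close> unfolding M_def near_def by auto
    have "dist p x \<le> dist p y + dist y x"
      by (rule dist_triangle)
    then show ?thesis
      using U D[of U y x] by linarith
  qed
  have "covering Y (m ` \<U>)"
    using cov unfolding covering_def m_def M_def by (auto split: if_splits)
  moreover have "uniformly_bounded (m ` \<U>)"
    unfolding uniformly_bounded_iff
  proof (intro exI ballI)
    fix V x y assume "V \<in> m ` \<U>" and xy: "x \<in> V" "y \<in> V"
    then obtain U where U: "U \<in> \<U>" "V = m U"
      by blast
    show "dist x y \<le> max D (2 * (\<rho> + R + D))"
    proof (cases "near U")
      case True
      then have "x \<in> M" "y \<in> M"
        using U xy by (auto simp: m_def)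
      then show ?thesis
        using M_near[of x] M_near[of y] dist_triangle3[of x y p] by (simp add: le_max_iff_disj)
    next
      case False
      then show ?thesis
        using U xy D[of U x y] by (simp add: m_def le_max_iff_disj)
    qed
  qed
  moreover have "multiplicity_le Y R (m ` \<U>) (n + 1)"
    unfolding multiplicity_le_def
  proof
    fix x assume "x \<in> Y"
    let ?V = "{V \<in> m ` \<U>. V \<inter> cball x R \<noteq> {}}"
    show "finite ?V \<and> card ?V \<le> n + 1"
    proof (cases "dist p x > \<rho>")
      case True
      let ?U = "{U \<in> \<U>. U \<inter> cball x R \<noteq> {}}"
      have U: "finite ?U" "card ?U \<le> n + 1"
        using mult True \<open>x \<in> Y\<close> unfolding multiplicity_le_def by auto
      \<comment> \<open>The ball may meet \<open>M\<close> in a point outside \<open>U\<close>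
        itself; that point lies in another near member, which \<open>m\<close> also sends to
        \<open>M\<close>.\<close>
      have "?V \<subseteq> m ` ?U"
      proof
        fix V assume "V \<in> ?V"
        then obtain U y where U: "U \<in> \<U>" "V = m U" "y \<in> m U" "y \<in> cball x R"
          by blast
        show "V \<in> m ` ?U"
        proof (cases "near U")
          case True
          then obtain U' where "U' \<in> \<U>" "near U'" "y \<in> U'"
            using U unfolding m_def M_def by auto
          moreover from this have "V = m U'"
            using True U by (simp add: m_def)
          ultimately show ?thesis
            using U by blast
        next
          case False
          then show ?thesis
            using U unfolding m_def by auto
        qed
      qed
      then show ?thesis
        using U by (meson card_image_le card_mono finite_imageI finite_subset le_trans)
    next
      case False
      have "near U" if "U \<inter> cball x R \<noteq> {}" for U
      proof -
        obtain y where "y \<in> U" "dist x y \<le> R"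
          using \<open>U \<inter> cball x R \<noteq> {}\<close> by auto
        then show ?thesis
          using False dist_triangle[of p y x] unfolding near_def by (force simp: not_less)
      qed
      then have "?V \<subseteq> {M}"
        unfolding m_def by auto
      then show ?thesis
        using card_mono[of "{M}" ?V] finite_subset[of ?V "{M}"] by simp
    qed
  qed
  ultimately show "\<exists>\<U>. covering Y \<U> \<and> uniformly_bounded \<U> \<and> multiplicity_le Y R \<U> (n + 1)"
    by blast
qed

section \<open>Iterated stars from coarse to fine scales\<close>

text \<open>The scales are passed through in decreasing order of \<open>k\<close>, so there is no
  first stage to recurse from. The least fixed point collects the points reached from
  \<open>A\<close> in finitely many steps, with at most one star per level.\<close>

inductive star_chain :: "(nat \<Rightarrow> 'a set set) \<Rightarrow> 'a set \<Rightarrow> nat \<Rightarrow> 'a \<Rightarrow> bool"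
  for W :: "nat \<Rightarrow> 'a set set" and A :: "'a set" where
  base: "x \<in> A \<Longrightarrow> star_chain W A k x"
| coarser: "star_chain W A (Suc k) x \<Longrightarrow> star_chain W A k x"
| star: "star_chain W A (Suc k) y \<Longrightarrow> U \<in> W k \<Longrightarrow> y \<in> U \<Longrightarrow> x \<in> U \<Longrightarrow> star_chain W A k x"

lemma star_chain_antimono:
  assumes "star_chain W A k x" "j \<le> k"
  shows "star_chain W A j x"
  using assms(2,1) by (induction rule: inc_induct) (auto intro: star_chain.coarser)

lemma star_chain_subset:
  assumes "star_chain W A k x" "A \<subseteq> X" "\<And>k. W k \<subseteq> Pow X"
  shows "x \<in> X"
  using assms by (induction rule: star_chain.induct) blast+

text \<open>Undoing the chain at level \<open>i\<close> moves the point by at most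
  \<open>S (Suc i) - S i\<close>, and these bounds telescope.\<close>

lemma star_chain_coarsen:
  fixes A :: "'a::metric_space set" and S :: "nat \<Rightarrow> real"
  assumes "\<And>k U x y. U \<in> W k \<Longrightarrow> x \<in> U \<Longrightarrow> y \<in> U \<Longrightarrow> dist x y \<le> S (Suc k) - S k"
    and "mono S" "star_chain W A k x" "k \<le> j"
  shows "\<exists>y. star_chain W A j y \<and> dist x y \<le> S j - S k"
  using assms(4)
proof (induction rule: dec_induct)
  case base
  then show ?case
    using assms(3) by auto
next
  case (step j)
  then obtain y where y: "star_chain W A j y" "dist x y \<le> S j - S k"
    by blast
  have "\<exists>z. star_chain W A (Suc j) z \<and> dist y z \<le> S (Suc j) - S j"
    using y(1)
  proof cases
    case base
    then show ?thesis
      using monoD[OF \<open>mono S\<close>, of j "Suc j"] by (auto intro!: exI[of _ y] star_chain.base)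
  next
    case coarser
    then show ?thesis
      using monoD[OF \<open>mono S\<close>, of j "Suc j"] by auto
  next
    case (star z U)
    then show ?thesis
      using assms(1) by blast
  qed
  then obtain z where "star_chain W A (Suc j) z" "dist y z \<le> S (Suc j) - S j"
    by blast
  then show ?case
    using y dist_triangle[of x z y] by force
qed

text \<open>The coarsest star of a chain, at level \<open>m\<close> say, dominates: all
  displacements together telescope to at most \<open>S (Suc m)\<close>, while \<open>far\<close>
  applies to the starting point in \<open>A\<close>, which lies in that star.\<close>

lemma star_chain_near:
  fixes A :: "'a::metric_space set" and S :: "nat \<Rightarrow> real"
  assumes W: "\<And>k U x y. U \<in> W k \<Longrightarrow> x \<in> U \<Longrightarrow> y \<in> U \<Longrightarrow> dist x y \<le> S (Suc k) - S k"
    and far: "\<And>k U x. U \<in> W k \<Longrightarrow> x \<in> U \<Longrightarrow> dist p x \<ge> L * S (Suc k)"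
    and "mono S" and S: "\<And>k. S k \<ge> 0" and "L \<ge> 0" and "star_chain W A k x"
  shows "\<exists>a\<in>A. L * dist x a \<le> dist p a"
proof -
  \<comment> \<open>The alternative \<open>x = a\<close> covers chains without stars. Subtracting
    \<open>S k\<close> leaves room for the next finer star.\<close>
  have "\<exists>a\<in>A. x = a \<or> (\<exists>m\<ge>k. dist x a \<le> S (Suc m) - S k \<and> dist p a \<ge> L * S (Suc m))"
    using assms(6)
  proof (induction rule: star_chain.induct)
    case (base x k)
    then show ?case
      by blast
  next
    case (coarser k x)
    then obtain a where a: "a \<in> A"
      "x = a \<or> (\<exists>m\<ge>Suc k. dist x a \<le> S (Suc m) - S (Suc k) \<and> dist p a \<ge> L * S (Suc m))"
      by blast
    have "S k \<le> S (Suc k)"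
      using \<open>mono S\<close> by (simp add: monoD)
    then have "dist x a \<le> S (Suc m) - S k" if "dist x a \<le> S (Suc m) - S (Suc k)" for m
      using that by linarith
    then show ?case
      using a Suc_leD by blast
  next
    case (star k y U x)
    then obtain a where a: "a \<in> A"
      "y = a \<or> (\<exists>m\<ge>Suc k. dist y a \<le> S (Suc m) - S (Suc k) \<and> dist p a \<ge> L * S (Suc m))"
      by blast
    have xy: "dist x y \<le> S (Suc k) - S k"
      using W star by blast
    show ?case
      using a(2)
    proof
      assume "y = a"
      then show ?thesis
        using a(1) xy far[OF star(2), of y] star by blast
    next
      assume "\<exists>m\<ge>Suc k. dist y a \<le> S (Suc m) - S (Suc k) \<and> dist p a \<ge> L * S (Suc m)"
      then obtain m where m: "m \<ge> Suc k" "dist y a \<le> S (Suc m) - S (Suc k)"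
        "dist p a \<ge> L * S (Suc m)"
        by blast
      have "dist x a \<le> S (Suc m) - S k"
        using xy m(2) dist_triangle[of x a y] by linarith
      then show ?thesis
        using a(1) m Suc_leD by blast
    qed
  qed
  then obtain a where a: "a \<in> A"
    "x = a \<or> (\<exists>m\<ge>k. dist x a \<le> S (Suc m) - S k \<and> dist p a \<ge> L * S (Suc m))"
    by blast
  have "L * dist x a \<le> dist p a"
    using a(2)
  proof
    assume "\<exists>m\<ge>k. dist x a \<le> S (Suc m) - S k \<and> dist p a \<ge> L * S (Suc m)"
    then obtain m where m: "dist x a \<le> S (Suc m) - S k" "dist p a \<ge> L * S (Suc m)"
      by blast
    have "L * dist x a \<le> L * S (Suc m)"
      using m(1) S[of k] \<open>L \<ge> 0\<close> by (intro mult_left_mono) auto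
    then show ?thesis
      using m(2) by linarith
  qed simp
  then show ?thesis
    using a(1) by blast
qed

section \<open>Separating the two ends of the geodesic\<close>

text \<open>Each tail of \<open>c\<close> lies in one component, which is deep by
  \<open>far\<close>. Along a connected set containing both tails, the distance to \<open>Z\<close>
  would pass from 0 to more than \<open>\<delta>\<close>, hence take the value
  \<open>\<delta>\<close> at a point of \<open>Y\<close>.\<close>

lemma coarsely_separatesI:
  fixes X :: "'a::metric_space set" and c :: "real \<Rightarrow> 'a"
  assumes c: "biinfinite_geodesic X c" and "Y \<subseteq> X" and "\<delta> > 0"
    and Y: "\<And>x. x \<in> X \<Longrightarrow> 0 < infdist x Z \<Longrightarrow> infdist x Z \<le> \<delta> \<Longrightarrow> x \<in> Y"
    and pos: "\<And>t. t \<ge> 0 \<Longrightarrow> c t \<in> Z"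
    and neg: "\<And>t. t \<ge> T \<Longrightarrow> infdist (c (- t)) Z > \<delta>"
    and far: "\<And>r. \<exists>t0. \<forall>t y. \<bar>t\<bar> \<ge> t0 \<longrightarrow> y \<in> Y \<longrightarrow> dist (c t) y \<ge> r"
  shows "coarsely_separates X Y"
proof -
  have cX: "c t \<in> X" for t
    using c unfolding biinfinite_geodesic_def by blast
  have cont: "continuous_on I c" for I
    using c unfolding biinfinite_geodesic_def continuous_on_iff dist_real_def by auto
  have "\<exists>t0. \<forall>t. \<bar>t\<bar> \<ge> t0 \<longrightarrow> c t \<notin> nbhd X r Y" for r
  proof -
    obtain t0 where t0: "\<And>t y. \<bar>t\<bar> \<ge> t0 \<Longrightarrow> y \<in> Y \<Longrightarrow> dist (c t) y \<ge> r + 1"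
      using far by blast
    have "c t \<notin> nbhd X r Y" if "\<bar>t\<bar> \<ge> t0" for t
    proof
      assume "c t \<in> nbhd X r Y"
      then have "Y \<noteq> {}" "infdist (c t) Y \<le> r"
        unfolding nbhd_def by auto
      moreover have "infdist (c t) Y \<ge> r + 1" if "Y \<noteq> {}"
        using that t0 \<open>\<bar>t\<bar> \<ge> t0\<close> by (auto simp: infdist_def intro!: cINF_greatest)
      ultimately show False
        by linarith
    qed
    then show ?thesis
      by blast
  qed
  then obtain t0 where t0: "\<And>r t. \<bar>t\<bar> \<ge> t0 r \<Longrightarrow> c t \<notin> nbhd X r Y"
    by metis
  define N where "N = X - nbhd X 1 Y"
  \<comment> \<open>Beyond \<open>s\<close>, both tails avoid the unit neighbourhood of
    \<open>Y\<close>, the positive one lies in \<open>Z\<close>, and the negative one is farther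
    than \<open>\<delta>\<close> from \<open>Z\<close>.\<close>
  define s where "s = max (max (t0 1) T) 0"
  define C where "C = connected_component_set N (c s)"
  define C' where "C' = connected_component_set N (c (- s))"
  have ray: "c ` {s..} \<subseteq> N" "c ` {..-s} \<subseteq> N"
    using t0[of 1] cX unfolding N_def s_def by auto
  have C: "c ` {s..} \<subseteq> C" "c ` {..-s} \<subseteq> C'"
    unfolding C_def C'_def
    by (intro connected_component_maximal connected_continuous_image cont ray; auto)+
  have "deep X Y C" "deep X Y C'"
  proof -
    have "c (max s (t0 r)) \<in> C - nbhd X r Y" "c (- max s (t0 r)) \<in> C' - nbhd X r Y" for r
      using t0[of r "max s (t0 r)"] t0[of r "- max s (t0 r)"] C by auto
    then show "deep X Y C" "deep X Y C'"
      unfolding deep_def by blast+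
  qed
  moreover have "C \<in> components N" "C' \<in> components N"
    using ray unfolding C_def C'_def by (auto intro!: componentsI)
  moreover have "C \<noteq> C'"
  proof
    assume "C = C'"
    then have "c s \<in> C" "c (- s) \<in> C"
      using C by auto
    have "connected C"
      unfolding C_def by simp
    then have "connected ((\<lambda>x. infdist x Z) ` C)"
      by (intro connected_continuous_image continuous_intros)
    moreover have "0 \<in> (\<lambda>x. infdist x Z) ` C"
      using pos[of s] \<open>c s \<in> C\<close> unfolding s_def by force
    moreover have "infdist (c (- s)) Z \<in> (\<lambda>x. infdist x Z) ` C"
      using \<open>c (- s) \<in> C\<close> by blast
    moreover have "infdist (c (- s)) Z > \<delta>"
      using neg unfolding s_def by simp
    ultimately have "\<delta> \<in> (\<lambda>x. infdist x Z) ` C"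
      using \<open>\<delta> > 0\<close> connectedD_interval by (meson less_imp_le)
    then obtain x where x: "x \<in> C" "infdist x Z = \<delta>"
      by blast
    have "x \<in> N"
      using x(1) connected_component_subset unfolding C_def by blast
    then have "x \<in> Y"
      using Y x(2) \<open>\<delta> > 0\<close> unfolding N_def by auto
    then have "x \<in> nbhd X 1 Y"
      using \<open>Y \<subseteq> X\<close> unfolding nbhd_def by auto
    then show False
      using \<open>x \<in> N\<close> unfolding N_def by blast
  qed
  ultimately show ?thesis
    unfolding coarsely_separates_def N_def by (metis zero_less_one)
qed

section \<open>The separating set and its dimension\<close>

text \<open>A finite infimum in \<open>enat\<close> is attained: \<open>Inf {}\<close> is infinite,
  and a nonempty set has a least element.\<close>

lemma asdim_le_if_asdim_eq:
  assumes "asdim X = enat n"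
  shows "asdim_le X n"
proof -
  have "{enat n | n. asdim_le X n} \<noteq> {}"
    using assms unfolding asdim_def by (metis Inf_enat_def enat.distinct(1) infinity_enat_def)
  then have "asdim X \<in> {enat n | n. asdim_le X n}"
    unfolding asdim_def by (metis (no_types, lifting) Inf_enat_def LeastI_ex ex_in_conv)
  then show ?thesis
    using assms by auto
qed

theorem theorem1p1:
  fixes X :: "'a::metric_space set" and n :: nat
  assumes "geodesic_space X"
    and "\<exists>c. biinfinite_geodesic X c"
    and "0 < n"
    and "asdim X = enat n"
  shows "\<exists>Y. Y \<subseteq> X \<and> asdim Y < enat n \<and> coarsely_separates X Y"
proof -
  obtain c where c: "biinfinite_geodesic X c"
    using assms(2) by blast
  have cX: "c t \<in> X" and c_dist: "dist (c s) (c t) = \<bar>s - t\<bar>" for s t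
    using c unfolding biinfinite_geodesic_def by auto
  have "\<exists>\<U> D. covering X \<U> \<and> D \<ge> 1 \<and> (\<forall>U\<in>\<U>. \<forall>x\<in>U. \<forall>y\<in>U. dist x y \<le> D) \<and>
      multiplicity_le X R \<U> (n + 1)" if "R > 0" for R
  proof -
    obtain \<U> D where "covering X \<U>" "\<forall>U\<in>\<U>. \<forall>x\<in>U. \<forall>y\<in>U. dist x y \<le> D"
      "multiplicity_le X R \<U> (n + 1)"
      using asdim_le_if_asdim_eq[OF assms(4)] \<open>R > 0\<close>
      unfolding asdim_le_def uniformly_bounded_iff by blast
    then show ?thesis
      by (intro exI[of _ \<U>] exI[of _ "max D 1"]) (auto simp: le_max_iff_disj)
  qed
  then obtain F E where
    F: "\<And>R. R > 0 \<Longrightarrow> covering X (F R)" "\<And>R. R > 0 \<Longrightarrow> multiplicity_le X R (F R) (n + 1)"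
    and E: "\<And>R. R > 0 \<Longrightarrow> E R \<ge> (1::real)"
      "\<And>R U x y. R > 0 \<Longrightarrow> U \<in> F R \<Longrightarrow> x \<in> U \<Longrightarrow> y \<in> U \<Longrightarrow> dist x y \<le> E R"
    by metis
  \<comment> \<open>Each increment is a diameter bound for the cover at the current scale; being at
    least 1, it makes the scales unbounded. The initial value 2 will absorb the distance from
    \<open>Y\<close> to \<open>Z\<close>.\<close>
  define S where "S = rec_nat 2 (\<lambda>_ R. R + E R)"
  have S_0: "S 0 = 2" and S_Suc: "S (Suc k) = S k + E (S k)" for k
    by (simp_all add: S_def)
  have S_ge: "S k \<ge> real k + 2" for k
  proof (induction k)
    case (Suc k)
    then show ?case
      using E(1)[of "S k"] by (simp add: S_Suc)
  qed (simp add: S_0)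
  have S_pos: "S k > 0" for k
    using S_ge[of k] by linarith
  have "mono S"
    using E(1)[OF S_pos] unfolding mono_iff_le_Suc S_Suc by (smt (verit))
  define W where "W k = {U \<in> F (S k). \<forall>x\<in>U. dist (c 0) x \<ge> 8 * S (Suc k)}" for k
  \<comment> \<open>The linear widening keeps \<open>c t\<close> at distance more than
    \<open>t / 4\<close> from every point of \<open>X\<close> outside the cone.\<close>
  define A where "A = {x \<in> X. \<exists>t\<ge>0. dist (c t) x \<le> t / 4}"
  define Z where "Z = Collect (star_chain W A 0)"
  define Y where "Y = {x \<in> X. 0 < infdist x Z \<and> infdist x Z \<le> 1}"
  have F_diam: "dist x y \<le> S (Suc k) - S k" if "U \<in> F (S k)" "x \<in> U" "y \<in> U" for k U x y
    using E(2)[OF S_pos that] by (simp add: S_Suc)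
  have F_sub: "F (S k) \<subseteq> Pow X" for k
    using F(1)[OF S_pos] unfolding covering_def by blast
  have W_diam: "dist x y \<le> S (Suc k) - S k" if "U \<in> W k" "x \<in> U" "y \<in> U" for k U x y
    using F_diam that unfolding W_def by blast
  have "A \<subseteq> Z"
    unfolding Z_def by (auto intro: star_chain.base)
  have Z_sub: "Z \<subseteq> X"
  proof
    fix z assume "z \<in> Z"
    then show "z \<in> X"
      using star_chain_subset[of W A 0 z X] F_sub unfolding Z_def W_def A_def by blast
  qed
  have pos: "c t \<in> A" if "t \<ge> 0" for t
    using that cX unfolding A_def by auto
  then have "Z \<noteq> {}"
    using \<open>A \<subseteq> Z\<close> by auto
  have YZ: "Y \<inter> Z = {}"
    unfolding Y_def by auto
  have neg: "dist (c (- s)) z \<ge> s" if "s \<ge> 0" "z \<in> Z" for s z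
  proof -
    have "\<exists>a\<in>A. 8 * dist z a \<le> dist (c 0) a"
      using that S_pos \<open>mono S\<close>
      by (intro star_chain_near[where W = W and S = S and k = 0] W_diam) (auto simp: Z_def W_def less_imp_le)
    then obtain a t where a: "8 * dist z a \<le> dist (c 0) a" "t \<ge> 0" "dist (c t) a \<le> t / 4"
      unfolding A_def by blast
    \<comment> \<open>So \<open>a\<close> is within \<open>5 * t / 4\<close> of \<open>c 0\<close>
      and \<open>z\<close> within \<open>5 * t / 32\<close> of \<open>a\<close>. Since
      \<open>5 / 32 + 1 / 4 < 1\<close>, the distance \<open>s + t\<close> between the points of
      \<open>c\<close> leaves at least \<open>s\<close>.\<close>
    have "dist (c 0) a \<le> dist (c 0) (c t) + dist (c t) a"
      by (rule dist_triangle)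
    moreover have "dist (c (- s)) (c t) \<le> dist (c (- s)) z + dist z a + dist (c t) a"
      by (smt (verit) dist_commute dist_triangle)
    ultimately show ?thesis
      using a that(1) by (simp add: c_dist)
  qed
  \<comment> \<open>The infimum need not be attained, so the bound 1 is relaxed to a strict
    2.\<close>
  have Y_near: "\<exists>z\<in>Z. dist y z < 2" if "y \<in> Y" for y
  proof -
    have "(INF z\<in>Z. dist y z) < 2"
      using that \<open>Z \<noteq> {}\<close> unfolding Y_def by (simp add: infdist_def)
    then show ?thesis
      using \<open>Z \<noteq> {}\<close> by (simp add: cINF_less_iff)
  qed
  have "coarsely_separates X Y"
  proof (rule coarsely_separatesI[OF c _ zero_less_one])
    show "Y \<subseteq> X"
      unfolding Y_def by blast
    show "x \<in> Y" if "x \<in> X" "0 < infdist x Z" "infdist x Z \<le> 1" for x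
      using that unfolding Y_def by blast
    show "c t \<in> Z" if "t \<ge> 0" for t
      using pos[OF that] \<open>A \<subseteq> Z\<close> by blast
    show "infdist (c (- t)) Z > 1" if "t \<ge> 2" for t
    proof -
      have "infdist (c (- t)) Z \<ge> 2"
        using neg[of t] that \<open>Z \<noteq> {}\<close> by (force simp: infdist_def intro!: cINF_greatest)
      then show ?thesis
        by simp
    qed
    show "\<exists>t0. \<forall>t y. \<bar>t\<bar> \<ge> t0 \<longrightarrow> y \<in> Y \<longrightarrow> dist (c t) y \<ge> r" for r
    \<comment> \<open>The factor 4 undoes the slope of the cone on the positive ray; the summand 2
      pays for passing from \<open>y\<close> to \<open>Z\<close> on the negative ray.\<close>
    proof (intro exI[of _ "4 * \<bar>r\<bar> + 2"] allI impI)
      fix t y assume t: "4 * \<bar>r\<bar> + 2 \<le> \<bar>t\<bar>" and y: "y \<in> Y"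
      show "dist (c t) y \<ge> r"
      proof (cases "t \<ge> 0")
        case True
        have "y \<notin> A" "y \<in> X"
          using y YZ \<open>A \<subseteq> Z\<close> unfolding Y_def by auto
        then have "dist (c t) y > t / 4"
          using True unfolding A_def by force
        then show ?thesis
          using t True by linarith
      next
        case False
        obtain z where "z \<in> Z" "dist y z < 2"
          using Y_near[OF y] by blast
        then show ?thesis
          using neg[of "- t" z] t False dist_triangle[of "c t" z y] by force
      qed
    qed
  qed
  moreover have "asdim_le Y (n - 1)"
  proof (rule asdim_le_if_eventually[of _ "c 0"])
    fix R :: real assume "R > 0"
    obtain k where "R \<le> real k"
      using real_arch_simple by blast
    then have R: "R \<le> S k"
      using S_ge[of k] by linarith
    let ?\<U> = "(\<lambda>U. U \<inter> Y) ` F (S k)"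
    have "covering Y ?\<U>"
      using F(1)[OF S_pos[of k]] unfolding covering_def Y_def by auto
    moreover have "uniformly_bounded ?\<U>"
      unfolding uniformly_bounded_iff using F_diam by blast
    \<comment> \<open>Of the factor 10, one unit is lost in passing from \<open>y\<close> to
      \<open>z\<close>, another within a member containing \<open>z\<close>; the 8 demanded by
      \<open>W\<close> remain.\<close>
    moreover have "multiplicity_le {x \<in> Y. dist (c 0) x > 10 * S (Suc k)} R ?\<U> (n - 1 + 1)"
      unfolding multiplicity_le_def
    proof
      fix y assume "y \<in> {x \<in> Y. dist (c 0) x > 10 * S (Suc k)}"
      then have y: "y \<in> Y" "dist (c 0) y > 10 * S (Suc k)"
        by auto
      obtain z0 where z0: "z0 \<in> Z" "dist y z0 < 2"
        using Y_near[OF y(1)] by blast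
      have "\<exists>z. star_chain W A k z \<and> dist z0 z \<le> S k - S 0"
        using z0(1) by (intro star_chain_coarsen W_diam \<open>mono S\<close>) (simp_all add: Z_def)
      then obtain z where z: "star_chain W A k z" "dist z0 z \<le> S k - S 0"
        by blast
      have yz: "dist y z < S k"
        using z0(2) z(2) dist_triangle[of y z z0] by (simp add: S_0)
      have z_far: "dist (c 0) z \<ge> 9 * S (Suc k)"
        using y(2) yz monoD[OF \<open>mono S\<close>, of k "Suc k"] dist_triangle[of "c 0" y z]
        by (simp add: dist_commute)
      \<comment> \<open>Either \<open>z\<close> was added by a star at level \<open>k\<close>, or it
        already has level \<open>Suc k\<close>; then any member of the cover containing it is far
        enough out to belong to \<open>W k\<close>.\<close>
      have "\<exists>U\<in>W k. z \<in> U \<and> (\<exists>x\<in>U. star_chain W A (Suc k) x)"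
      proof -
        have *: ?thesis if "star_chain W A (Suc k) z"
        proof -
          have "z \<in> X"
            using z(1) Z_sub star_chain_antimono[of W A k z 0] unfolding Z_def by blast
          then obtain U where U: "U \<in> F (S k)" "z \<in> U"
            using F(1)[OF S_pos[of k]] unfolding covering_def by blast
          have "dist (c 0) x \<ge> 8 * S (Suc k)" if "x \<in> U" for x
            using F_diam[OF U that] z_far S_pos[of k] dist_triangle[of "c 0" z x]
            by (simp add: dist_commute)
          then have "U \<in> W k"
            using U unfolding W_def by blast
          then show ?thesis
            using U that by blast
        qed
        show ?thesis
          using z(1)
        proof cases
          case base
          then show ?thesis
            using * star_chain.base by metis
        next
          case coarser
          then show ?thesis
            using * by blast
        next
          case (star x U)
          then show ?thesis
            by blast
        qed
      qed
      then obtain U x where U: "U \<in> W k" "z \<in> U" "x \<in> U" "star_chain W A (Suc k) x"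
        by blast
      have "U \<subseteq> Z"
        using star_chain.star[OF U(4,1,3)] star_chain_antimono[of W A k _ 0] unfolding Z_def by blast
      then have UY: "U \<inter> Y = {}"
        using YZ by blast
      let ?B = "{V \<in> F (S k). V \<inter> cball y (S k) \<noteq> {}}"
      have B: "finite ?B" "card ?B \<le> n + 1"
        using F(2)[OF S_pos[of k]] y(1) unfolding multiplicity_le_def Y_def by auto
      have "U \<in> ?B"
        using U yz unfolding W_def by (auto intro: less_imp_le)
      then have "card (?B - {U}) \<le> n"
        using B by simp
      then have "card ((\<lambda>V. V \<inter> Y) ` (?B - {U})) \<le> n"
        using B(1) card_image_le[of "?B - {U}" "\<lambda>V. V \<inter> Y"] by (meson finite_Diff le_trans)
      \<comment> \<open>Discarding \<open>U\<close> loses no trace meeting the ball, because its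
        trace on \<open>Y\<close> is empty.\<close>
      moreover have "{V \<in> ?\<U>. V \<inter> cball y R \<noteq> {}} \<subseteq> (\<lambda>V. V \<inter> Y) ` (?B - {U})"
        using UY subset_cball[OF R, of y] by blast
      ultimately show "finite {V \<in> ?\<U>. V \<inter> cball y R \<noteq> {}} \<and>
          card {V \<in> ?\<U>. V \<inter> cball y R \<noteq> {}} \<le> n - 1 + 1"
        using B(1) \<open>0 < n\<close>
        by (metis (no_types, lifting) Suc_diff_1 Suc_eq_plus1 card_mono finite_Diff finite_imageI
            finite_subset le_trans)
    qed
    ultimately show "\<exists>\<U> \<rho>. covering Y \<U> \<and> uniformly_bounded \<U> \<and>
        multiplicity_le {x \<in> Y. dist (c 0) x > \<rho>} R \<U> (n - 1 + 1)"
      by blast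
  qed
  then have "asdim Y \<le> enat (n - 1)"
    unfolding asdim_def by (auto intro: Inf_lower)
  then have "asdim Y < enat n"
    using \<open>0 < n\<close> by (metis diff_less enat_ord_simps(2) le_less_trans zero_less_one)
  moreover have "Y \<subseteq> X"
    unfolding Y_def by blast
  ultimately show ?thesis
    by blast
qed

end
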